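(* Given independent standard one-dimensional Brownian motions $B_1$ and $B_2$ with $B_j(0)=0$, and constants $x>0$, $0\le y\le x$, $v\in\mathbb{R}$, $K>0$, there exist unique processes $L_1(t)$ and $L_2(t)$, and a random time $T_\infty$, satisfying the following conditions: 1. $X_1(t)\le Y(t)\le X_2(t)$ for $0\le t\le T_\infty$, where (a) $X_1(t)= B_1(t)-L_1(t)$, (b) $X_2(t)= x+B_2(t)+L_2(t)$, (c) $V(t)= v+K(L_1(t)-L_2(t))$, (d) $Y(t)= y+\int_0^tV(s)\,ds$; 2. $L_1(t)$ and $L_2(t)$ are continuous, nondecreasing functions with $L_1(0)=L_2(0)=0$; 3. $L_1(t)$ and $L_2(t)$ are flat off the sets $\{t:X_1(t)=Y(t)\}$ and $\{t:X_2(t)=Y(t)\}$, respectively; 4. $T_\infty=\inf\{t:X_1(t)=X_2(t)\}$.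
   Context: A nondecreasing continuous function $L$ is flat off a closed set $S$ if $\int 1_{\{s\notin S\}}\,dL(s)=0$. $\inf\emptyset=\infty$. The processes are considered only up to time $T_\infty$ (they are not defined after $T_\infty$), and existence and uniqueness are understood up to that time. *)

theory Defs
  imports "HOL-Probability.Probability"
begin

definition standard_brownian_motion :: "'a measure \<Rightarrow> (real \<Rightarrow> 'a \<Rightarrow> real) \<Rightarrow> bool" where
  "standard_brownian_motion M B \<longleftrightarrow>
     prob_space M \<and>
     (\<forall>t\<ge>0. B t \<in> borel_measurable M) \<and>
     (AE \<omega> in M. B 0 \<omega> = 0) \<and>
     (AE \<omega> in M. continuous_on {0..} (\<lambda>t. B t \<omega>)) \<and>
     (\<forall>s t. 0 \<le> s \<longrightarrow> s < t \<longrightarrow>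
        distributed M lborel (\<lambda>\<omega>. B t \<omega> - B s \<omega>) (normal_density 0 (sqrt (t - s)))) \<and>
     (\<forall>(n::nat) (\<tau>::nat \<Rightarrow> real). 0 \<le> \<tau> 0 \<longrightarrow> (\<forall>i<n. \<tau> i < \<tau> (Suc i)) \<longrightarrow>
        prob_space.indep_vars M (\<lambda>_. borel) (\<lambda>i \<omega>. B (\<tau> (Suc i)) \<omega> - B (\<tau> i) \<omega>) {..<n})"

text \<open>Independence of whole processes: the path-valued random variables are independent
  for the product sigma-algebra on functions on the half-line.\<close>

definition independent_processes ::
    "'a measure \<Rightarrow> (real \<Rightarrow> 'a \<Rightarrow> real) \<Rightarrow> (real \<Rightarrow> 'a \<Rightarrow> real) \<Rightarrow> bool" where
  "independent_processes M B B' \<longleftrightarrow>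
     prob_space.indep_var M
       (PiM {0..} (\<lambda>_. borel)) (\<lambda>\<omega>. \<lambda>t\<in>{0..}. B t \<omega>)
       (PiM {0..} (\<lambda>_. borel)) (\<lambda>\<omega>. \<lambda>t\<in>{0..}. B' t \<omega>)"

definition times_upto :: "ereal \<Rightarrow> real set" where
  "times_upto T = {t. 0 \<le> t \<and> ereal t \<le> T}"

text \<open>A process that is defined only up to the random time \<open>T\<close>: its values (and hence their
  measurability) matter only on the events \<open>{t \<le> T}\<close>.\<close>

definition process_upto :: "'a measure \<Rightarrow> ('a \<Rightarrow> ereal) \<Rightarrow> (real \<Rightarrow> 'a \<Rightarrow> real) \<Rightarrow> bool" where
  "process_upto M T L \<longleftrightarrow>
     (\<forall>t\<ge>0. L t \<in> borel_measurable (restrict_space M {\<omega> \<in> space M. ereal t \<le> T \<omega>}))"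

text \<open>Extension of a path on \<open>times_upto T\<close> to the whole line, constant to the left of \<open>0\<close> and
  to the right of \<open>T\<close>; the Stieltjes measure of the extension is that of the path on
  \<open>times_upto T\<close> and vanishes elsewhere.\<close>

definition clamp_path :: "ereal \<Rightarrow> (real \<Rightarrow> real) \<Rightarrow> real \<Rightarrow> real" where
  "clamp_path T l s = l (real_of_ereal (max 0 (min (ereal s) T)))"

text \<open>Meaningful for nondecreasing continuous \<open>l\<close> (on the whole line) and closed \<open>S\<close>:
  \<open>interval_measure l\<close> is then the Lebesgue-Stieltjes measure of \<open>l\<close>.\<close>

definition flat_off :: "(real \<Rightarrow> real) \<Rightarrow> real set \<Rightarrow> bool" where
  "flat_off l S \<longleftrightarrow> (\<integral>\<^sup>+ s. indicator {s. s \<notin> S} s \<partial>interval_measure l) = 0"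

definition path_X1 :: "(real \<Rightarrow> real) \<Rightarrow> (real \<Rightarrow> real) \<Rightarrow> real \<Rightarrow> real" where
  "path_X1 b1 l1 t = b1 t - l1 t"

definition path_X2 :: "real \<Rightarrow> (real \<Rightarrow> real) \<Rightarrow> (real \<Rightarrow> real) \<Rightarrow> real \<Rightarrow> real" where
  "path_X2 x b2 l2 t = x + b2 t + l2 t"

definition path_V :: "real \<Rightarrow> real \<Rightarrow> (real \<Rightarrow> real) \<Rightarrow> (real \<Rightarrow> real) \<Rightarrow> real \<Rightarrow> real" where
  "path_V v K l1 l2 t = v + K * (l1 t - l2 t)"

definition path_Y :: "real \<Rightarrow> real \<Rightarrow> real \<Rightarrow> (real \<Rightarrow> real) \<Rightarrow> (real \<Rightarrow> real) \<Rightarrow> real \<Rightarrow> real" where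
  "path_Y y v K l1 l2 t = y + integral {0..t} (path_V v K l1 l2)"

text \<open>In the last condition the infimum only ranges over times up to \<open>T\<close>, because the paths are not
  defined later. So a finite \<open>T\<close> is the first meeting time, and \<open>T = \<infinity>\<close> (the infimum of the empty
  set) means that the paths never meet.\<close>

definition inert_path_system ::
    "real \<Rightarrow> real \<Rightarrow> real \<Rightarrow> real \<Rightarrow> (real \<Rightarrow> real) \<Rightarrow> (real \<Rightarrow> real) \<Rightarrow>
     (real \<Rightarrow> real) \<Rightarrow> (real \<Rightarrow> real) \<Rightarrow> ereal \<Rightarrow> bool" where
  "inert_path_system x y v K b1 b2 l1 l2 T \<longleftrightarrow>
     (let X1 = path_X1 b1 l1; X2 = path_X2 x b2 l2; Y = path_Y y v K l1 l2 in
       (\<forall>t\<in>times_upto T. X1 t \<le> Y t \<and> Y t \<le> X2 t) \<and>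
       continuous_on (times_upto T) l1 \<and> mono_on (times_upto T) l1 \<and> l1 0 = 0 \<and>
       continuous_on (times_upto T) l2 \<and> mono_on (times_upto T) l2 \<and> l2 0 = 0 \<and>
       flat_off (clamp_path T l1) {t \<in> times_upto T. X1 t = Y t} \<and>
       flat_off (clamp_path T l2) {t \<in> times_upto T. X2 t = Y t} \<and>
       T = Inf (ereal ` {t \<in> times_upto T. X1 t = X2 t}))"

definition inert_solution ::
    "'a measure \<Rightarrow> real \<Rightarrow> real \<Rightarrow> real \<Rightarrow> real \<Rightarrow> (real \<Rightarrow> 'a \<Rightarrow> real) \<Rightarrow> (real \<Rightarrow> 'a \<Rightarrow> real) \<Rightarrow>
     (real \<Rightarrow> 'a \<Rightarrow> real) \<Rightarrow> (real \<Rightarrow> 'a \<Rightarrow> real) \<Rightarrow> ('a \<Rightarrow> ereal) \<Rightarrow> bool" where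
  "inert_solution M x y v K B1 B2 L1 L2 T \<longleftrightarrow>
     T \<in> borel_measurable M \<and> process_upto M T L1 \<and> process_upto M T L2 \<and>
     (AE \<omega> in M. inert_path_system x y v K (\<lambda>t. B1 t \<omega>) (\<lambda>t. B2 t \<omega>)
                   (\<lambda>t. L1 t \<omega>) (\<lambda>t. L2 t \<omega>) (T \<omega>))"

end

theory Submission
  imports Defs
begin

text \<open>
  The system is solved path by path: the solution is a deterministic functional of two continuous
  paths that start from \<open>0\<close>.

  Suppose first that \<open>Y\<close> is known. Then \<open>L1\<close> has to be nondecreasing, has to keep \<open>B1 - L1\<close> below \<open>Y\<close>,
  and may grow only when \<open>B1 - L1 = Y\<close>. This is the one-dimensional Skorokhod problem, whose only
  solution is the running maximum of the positive part of \<open>B1 - Y\<close> (\<open>skorokhod_unique\<close>,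
  \<open>skorokhod_exists\<close>). In the same way \<open>L2\<close> is the running maximum of the positive part of
  \<open>Y - (x + B2)\<close>; the hypothesis \<open>0 \<le> y \<le> x\<close> makes both start from \<open>0\<close>.

  What remains is one equation for the barrier \<open>Y\<close>: it is a fixed point of the map that sends \<open>Y\<close>
  to \<open>y\<close> plus the integral of \<open>v + K (L1 - L2)\<close>, with the regulators \<open>L1\<close> and \<open>L2\<close> just described.
  A running maximum moves by at most \<open>c\<close> when its argument moves by at most \<open>c\<close>, so the integrand is
  Lipschitz with constant \<open>2 K\<close> in the supremum norm on \<open>[0,t]\<close>. The map is therefore a contraction
  with factor \<open>1/2\<close> for the norm weighted by \<open>exp (- 4 K t)\<close> (\<open>barrier_map_contraction\<close>). Hence the
  fixed point is unique on every interval \<open>[0,\<tau>]\<close>, and Picard iteration converges to a fixed point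
  on the whole half-line. In particular no explosion can occur before the paths \<open>X1\<close> and \<open>X2\<close> meet,
  and \<open>T\<close> is simply the first zero of \<open>X2 - X1\<close>.

  Two solutions agree as long as both are defined. If one of them stops at a finite time, its paths
  meet there, hence so do those of the other one, which then stops as well; so the two times are equal
  (\<open>inert_path_system_time_le\<close>).

  Measurability is inherited by the Picard iterates, since running maxima and integrals of
  continuous paths are determined by countably many coordinates, and then by their limit.
\<close>

section \<open>The running maximum\<close>

text \<open>The positive part is built in because this is the form that solves the Skorokhod problem: a
  regulator starts at \<open>0\<close> and does not react as long as the driving path stays negative.\<close>

definition running_max :: "(real \<Rightarrow> real) \<Rightarrow> real \<Rightarrow> real" where
  "running_max g t = (SUP s\<in>{0..t}. max 0 (g s))"

lemma running_max_upper:
  assumes "continuous_on {0..t} g" "s \<in> {0..t}"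
  shows "g s \<le> running_max g t" "0 \<le> running_max g t"
proof -
  have "continuous_on {0..t} (\<lambda>s. max 0 (g s))"
    by (intro continuous_intros assms)
  then have "bdd_above ((\<lambda>s. max 0 (g s)) ` {0..t})"
    by (intro bounded_imp_bdd_above compact_imp_bounded compact_continuous_image) auto
  then have "max 0 (g s) \<le> running_max g t"
    unfolding running_max_def using assms(2) by (rule cSUP_upper2) auto
  then show "g s \<le> running_max g t" "0 \<le> running_max g t" by auto
qed

lemma running_max_least:
  assumes "0 \<le> t" "0 \<le> a" "\<And>s. s \<in> {0..t} \<Longrightarrow> g s \<le> a"
  shows "running_max g t \<le> a"
  unfolding running_max_def using assms by (intro cSUP_least) auto

lemma running_max_mono:
  assumes "continuous_on {0..t} g" "0 \<le> s" "s \<le> t"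
  shows "running_max g s \<le> running_max g t"
  using assms by (intro running_max_least running_max_upper(1) running_max_upper(2)[of t g 0]) auto

lemma running_max_start:
  assumes "g 0 \<le> 0"
  shows "running_max g 0 = 0"
  using assms by (simp add: running_max_def max_absorb1)

lemma running_max_nonexpansive:
  assumes "0 \<le> t" "continuous_on {0..t} g" "continuous_on {0..t} h"
    and "\<And>s. s \<in> {0..t} \<Longrightarrow> \<bar>g s - h s\<bar> \<le> c"
  shows "\<bar>running_max g t - running_max h t\<bar> \<le> c"
proof -
  have le: "running_max f t \<le> running_max k t + c"
    if "continuous_on {0..t} k" "\<And>s. s \<in> {0..t} \<Longrightarrow> \<bar>f s - k s\<bar> \<le> c" for f k
  proof (rule running_max_least)
    have "0 \<le> c" using that(2)[of 0] assms(1) by auto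
    then show "0 \<le> running_max k t + c"
      using running_max_upper(2)[OF that(1), of 0] assms(1) by auto
    show "f s \<le> running_max k t + c" if "s \<in> {0..t}" for s
      using running_max_upper(1)[OF \<open>continuous_on {0..t} k\<close> that]
        \<open>\<And>s. s \<in> {0..t} \<Longrightarrow> \<bar>f s - k s\<bar> \<le> c\<close>[OF that] by linarith
  qed (use assms in auto)
  have "running_max g t \<le> running_max h t + c" using assms by (intro le) auto
  moreover have "running_max h t \<le> running_max g t + c"
    using assms by (intro le) (auto simp: abs_minus_commute)
  ultimately show ?thesis by linarith
qed

lemma running_max_cong:
  "(\<And>s. s \<in> {0..t} \<Longrightarrow> g s = h s) \<Longrightarrow> running_max g t = running_max h t"
  unfolding running_max_def by (intro SUP_cong) auto

text \<open>Up to time \<open>t\<close> the maximum is taken either before \<open>s\<close> or in \<open>[s,t]\<close>. This yields both the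
  continuity of the running maximum and the fact that it is constant where the path stays below it.\<close>

lemma running_max_increment:
  assumes "continuous_on {0..t} g" "0 \<le> s" "s \<le> t" "running_max g s \<le> a"
    and "\<And>r. r \<in> {s..t} \<Longrightarrow> g r \<le> a"
  shows "running_max g t \<le> a"
proof (rule running_max_least)
  have c: "continuous_on {0..s} g" using assms by (auto intro: continuous_on_subset)
  show "0 \<le> t" using assms by simp
  show "0 \<le> a" using running_max_upper(2)[OF c, of 0] assms by auto
  show "g r \<le> a" if "r \<in> {0..t}" for r
    using running_max_upper(1)[OF c, of r] assms that by (cases "r \<le> s") force+
qed

lemma continuous_on_running_max:
  assumes g: "continuous_on {0..t} g"
  shows "continuous_on {0..t} (running_max g)"
proof -
  have u: "uniformly_continuous_on {0..t} g"
    using g by (intro compact_uniformly_continuous) auto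
  show ?thesis
    unfolding continuous_on_iff
  proof (intro ballI allI impI)
    fix s and e :: real
    assume s: "s \<in> {0..t}" and e: "0 < e"
    then obtain d where d: "0 < d"
      "\<And>p q. p \<in> {0..t} \<Longrightarrow> q \<in> {0..t} \<Longrightarrow> dist p q < d \<Longrightarrow> dist (g p) (g q) < e/2"
      using u unfolding uniformly_continuous_on_def by (metis half_gt_zero)
    have step: "running_max g q \<le> running_max g p + e/2 \<and> running_max g p \<le> running_max g q"
      if "0 \<le> p" "p \<le> q" "q \<le> t" "dist p q < d" for p q
    proof
      have cq: "continuous_on {0..q} g" and cp: "continuous_on {0..p} g"
        using g that by (auto intro: continuous_on_subset)
      show "running_max g q \<le> running_max g p + e/2"
      proof (rule running_max_increment[OF cq \<open>0 \<le> p\<close> \<open>p \<le> q\<close>])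
        show "g r \<le> running_max g p + e/2" if "r \<in> {p..q}" for r
        proof -
          have "dist (g r) (g p) < e/2"
            using that \<open>0 \<le> p\<close> \<open>q \<le> t\<close> \<open>dist p q < d\<close> by (intro d) (auto simp: dist_real_def)
          then have "g r \<le> g p + e/2" unfolding dist_real_def by linarith
          then show ?thesis
            using running_max_upper(1)[OF cp, of p] \<open>0 \<le> p\<close> by simp
        qed
      qed (use e in simp)
      show "running_max g p \<le> running_max g q"
        using cq that by (intro running_max_mono) auto
    qed
    have "dist (running_max g r) (running_max g s) < e" if "r \<in> {0..t}" "dist r s < d" for r
    proof (cases "r \<le> s")
      case True
      then show ?thesis using step[of r s] s e that by (auto simp: dist_real_def)
    next
      case False
      then show ?thesis using step[of s r] s e that by (auto simp: dist_real_def)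
    qed
    with d(1) show "\<exists>d>0. \<forall>r\<in>{0..t}. dist r s < d \<longrightarrow> dist (running_max g r) (running_max g s) < e"
      by blast
  qed
qed

section \<open>The fixed point equation for the barrier\<close>

text \<open>The right-hand side of the integral equation for the barrier once the two regulators have been expressed through it.\<close>

definition barrier_map ::
    "real \<Rightarrow> real \<Rightarrow> real \<Rightarrow> real \<Rightarrow> (real \<Rightarrow> real) \<Rightarrow> (real \<Rightarrow> real) \<Rightarrow> (real \<Rightarrow> real) \<Rightarrow> real \<Rightarrow> real"
  where
  "barrier_map x y v K b1 b2 Y =
     path_Y y v K (running_max (\<lambda>s. b1 s - Y s)) (running_max (\<lambda>s. Y s - (x + b2 s)))"

lemma continuous_on_path_V:
  "continuous_on A l1 \<Longrightarrow> continuous_on A l2 \<Longrightarrow> continuous_on A (path_V v K l1 l2)"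
  unfolding path_V_def[abs_def] by (intro continuous_intros)

lemma continuous_on_path_Y:
  assumes "continuous_on {0..\<tau>} l1" "continuous_on {0..\<tau>} l2"
  shows "continuous_on {0..\<tau>} (path_Y y v K l1 l2)"
  unfolding path_Y_def[abs_def]
  by (intro continuous_intros indefinite_integral_continuous_1 integrable_continuous_real
      continuous_on_path_V assms)

lemma path_Y_cong:
  assumes "\<And>s. s \<in> {0..t} \<Longrightarrow> l1 s = l1' s" "\<And>s. s \<in> {0..t} \<Longrightarrow> l2 s = l2' s"
  shows "path_Y y v K l1 l2 t = path_Y y v K l1' l2' t"
  unfolding path_Y_def using assms
  by (auto intro!: integral_cong simp: path_V_def)

lemma continuous_on_barrier_map:
  assumes "continuous_on {0..\<tau>} b1" "continuous_on {0..\<tau>} b2" "continuous_on {0..\<tau>} Y"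
  shows "continuous_on {0..\<tau>} (barrier_map x y v K b1 b2 Y)"
  unfolding barrier_map_def
  by (intro continuous_on_path_Y continuous_on_running_max continuous_intros assms)

text \<open>The weight is what makes the estimate global. If the arguments differ by at most
  \<open>C exp (4 K s)\<close>, then so do, by monotonicity of the weight, their running maxima; the two
  integrands differ by at most \<open>2 K C exp (4 K s)\<close>, and integration divides by \<open>4 K\<close>. The factor
  \<open>1/2\<close> does not depend on the length of the interval.\<close>

lemma barrier_map_contraction:
  assumes K: "K > 0" and t: "t \<in> {0..\<tau>}"
    and b: "continuous_on {0..\<tau>} b1" "continuous_on {0..\<tau>} b2"
    and YZ: "continuous_on {0..\<tau>} Y" "continuous_on {0..\<tau>} Z"
    and le: "\<And>s. s \<in> {0..\<tau>} \<Longrightarrow> \<bar>Y s - Z s\<bar> \<le> C * exp (4 * K * s)"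
  shows "\<bar>barrier_map x y v K b1 b2 Y t - barrier_map x y v K b1 b2 Z t\<bar> \<le> C / 2 * exp (4 * K * t)"
proof -
  define F where "F Y = path_V v K (running_max (\<lambda>s. b1 s - Y s)) (running_max (\<lambda>s. Y s - (x + b2 s)))"
    for Y
  have C: "0 \<le> C" using le[of 0] t by auto
  have cont: "continuous_on {0..t} (F W)" if "continuous_on {0..\<tau>} W" for W
  proof -
    have "continuous_on {0..\<tau>} (F W)" unfolding F_def
      by (intro continuous_on_path_V continuous_on_running_max continuous_intros that b)
    then show ?thesis using t by (auto intro: continuous_on_subset)
  qed
  have prim: "((\<lambda>s. 2 * K * C * exp (4 * K * s)) has_integral
      C / 2 * exp (4 * K * t) - C / 2 * exp (4 * K * 0)) {0..t}"
    using t K by (intro fundamental_theorem_of_calculus)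
      (auto intro!: derivative_eq_intros simp flip: has_real_derivative_iff_has_vector_derivative)
  have diff: "\<bar>F Y s - F Z s\<bar> \<le> 2 * K * C * exp (4 * K * s)" if s: "s \<in> {0..t}" for s
  proof -
    have sub: "continuous_on {0..s} f" if "continuous_on {0..\<tau>} f" for f :: "real \<Rightarrow> real"
      using that s t by (auto intro: continuous_on_subset)
    have le': "\<bar>Y r - Z r\<bar> \<le> C * exp (4 * K * s)" if "r \<in> {0..s}" for r
    proof -
      have "\<bar>Y r - Z r\<bar> \<le> C * exp (4 * K * r)" using le that s t by auto
      also have "\<dots> \<le> C * exp (4 * K * s)" using that C K by (intro mult_left_mono) auto
      finally show ?thesis .
    qed
    have "\<bar>running_max (\<lambda>s. b1 s - Y s) s - running_max (\<lambda>s. b1 s - Z s) s\<bar> \<le> C * exp (4 * K * s)"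
      using s le' by (intro running_max_nonexpansive continuous_intros sub b YZ)
        (auto simp: abs_minus_commute)
    moreover have "\<bar>running_max (\<lambda>s. Y s - (x + b2 s)) s - running_max (\<lambda>s. Z s - (x + b2 s)) s\<bar>
        \<le> C * exp (4 * K * s)"
      using s le' by (intro running_max_nonexpansive continuous_intros sub b YZ) auto
    ultimately have "\<bar>(running_max (\<lambda>s. b1 s - Y s) s - running_max (\<lambda>s. b1 s - Z s) s)
        - (running_max (\<lambda>s. Y s - (x + b2 s)) s - running_max (\<lambda>s. Z s - (x + b2 s)) s)\<bar>
        \<le> 2 * (C * exp (4 * K * s))" by linarith
    then have "K * \<bar>(running_max (\<lambda>s. b1 s - Y s) s - running_max (\<lambda>s. b1 s - Z s) s)
        - (running_max (\<lambda>s. Y s - (x + b2 s)) s - running_max (\<lambda>s. Z s - (x + b2 s)) s)\<bar>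
        \<le> K * (2 * (C * exp (4 * K * s)))" using K by (intro mult_left_mono) auto
    moreover have "F Y s - F Z s = K * ((running_max (\<lambda>s. b1 s - Y s) s - running_max (\<lambda>s. b1 s - Z s) s)
        - (running_max (\<lambda>s. Y s - (x + b2 s)) s - running_max (\<lambda>s. Z s - (x + b2 s)) s))"
      unfolding F_def path_V_def by (simp add: algebra_simps)
    ultimately show ?thesis using K by (simp add: abs_mult mult_ac)
  qed
  have int: "F Y integrable_on {0..t}" "F Z integrable_on {0..t}"
    using cont YZ by (auto intro: integrable_continuous_real)
  have "barrier_map x y v K b1 b2 Y t - barrier_map x y v K b1 b2 Z t
      = integral {0..t} (\<lambda>s. F Y s - F Z s)"
    using int by (simp add: barrier_map_def path_Y_def F_def integral_diff)
  also have "\<bar>\<dots>\<bar> \<le> integral {0..t} (\<lambda>s. 2 * K * C * exp (4 * K * s))"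
    using integral_norm_bound_integral[OF integrable_diff[OF int] has_integral_integrable[OF prim]] diff
    by simp
  also have "\<dots> = C / 2 * exp (4 * K * t) - C / 2" using integral_unique[OF prim] by simp
  also have "\<dots> \<le> C / 2 * exp (4 * K * t)" using C by simp
  finally show ?thesis .
qed

lemma exp_weighted_bound:
  fixes f :: "real \<Rightarrow> real"
  assumes K: "K > 0" and "continuous_on {0..\<tau>} f"
  obtains C where "\<And>s. s \<in> {0..\<tau>} \<Longrightarrow> \<bar>f s\<bar> \<le> C * exp (4 * K * s)"
proof -
  have "bounded (f ` {0..\<tau>})"
    by (intro compact_imp_bounded compact_continuous_image assms compact_Icc)
  then obtain C where C: "C > 0" "\<And>s. s \<in> {0..\<tau>} \<Longrightarrow> \<bar>f s\<bar> \<le> C"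
    unfolding bounded_pos by auto
  have "\<bar>f s\<bar> \<le> C * exp (4 * K * s)" if "s \<in> {0..\<tau>}" for s
  proof -
    have "C * 1 \<le> C * exp (4 * K * s)" using that K C(1) by (intro mult_left_mono) auto
    then show ?thesis using C(2)[OF that] by simp
  qed
  then show ?thesis by (rule that)
qed

text \<open>Applying the contraction \<open>n\<close> times bounds the distance of two fixed points by a multiple of
  \<open>(1/2) ^ n\<close>.\<close>

lemma barrier_unique:
  assumes K: "K > 0"
    and b: "continuous_on {0..\<tau>} b1" "continuous_on {0..\<tau>} b2"
    and YZ: "continuous_on {0..\<tau>} Y" "continuous_on {0..\<tau>} Z"
    and fix_Y: "\<And>s. s \<in> {0..\<tau>} \<Longrightarrow> Y s = barrier_map x y v K b1 b2 Y s"
    and fix_Z: "\<And>s. s \<in> {0..\<tau>} \<Longrightarrow> Z s = barrier_map x y v K b1 b2 Z s"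
    and t: "t \<in> {0..\<tau>}"
  shows "Y t = Z t"
proof -
  obtain C where C: "\<And>s. s \<in> {0..\<tau>} \<Longrightarrow> \<bar>Y s - Z s\<bar> \<le> C * exp (4 * K * s)"
    using exp_weighted_bound[OF K, of \<tau> "\<lambda>s. Y s - Z s"] YZ by (auto intro: continuous_intros)
  have bound: "\<forall>s\<in>{0..\<tau>}. \<bar>Y s - Z s\<bar> \<le> (C * (1/2)^n) * exp (4 * K * s)" for n
  proof (induction n)
    case (Suc n)
    show ?case
    proof
      fix s assume s: "s \<in> {0..\<tau>}"
      show "\<bar>Y s - Z s\<bar> \<le> (C * (1/2)^Suc n) * exp (4 * K * s)"
        using barrier_map_contraction[OF K s b YZ, of "C * (1/2)^n" x y v] Suc
          fix_Y[OF s] fix_Z[OF s] by auto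
    qed
  qed (use C in auto)
  have "(\<lambda>n. (C * (1/2)^n) * exp (4 * K * t)) \<longlonglongrightarrow> (C * 0) * exp (4 * K * t)"
    by (intro tendsto_intros LIMSEQ_realpow_zero) auto
  then have "\<bar>Y t - Z t\<bar> \<le> 0"
    using bound t by (intro LIMSEQ_le_const[where X = "\<lambda>n. (C * (1/2)^n) * exp (4 * K * t)"]) auto
  then show ?thesis by simp
qed

primrec picard ::
    "real \<Rightarrow> real \<Rightarrow> real \<Rightarrow> real \<Rightarrow> (real \<Rightarrow> real) \<Rightarrow> (real \<Rightarrow> real) \<Rightarrow> nat \<Rightarrow> real \<Rightarrow> real" where
  "picard x y v K b1 b2 0 = (\<lambda>t. y)"
| "picard x y v K b1 b2 (Suc n) = barrier_map x y v K b1 b2 (picard x y v K b1 b2 n)"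

definition barrier ::
    "real \<Rightarrow> real \<Rightarrow> real \<Rightarrow> real \<Rightarrow> (real \<Rightarrow> real) \<Rightarrow> (real \<Rightarrow> real) \<Rightarrow> real \<Rightarrow> real" where
  "barrier x y v K b1 b2 t = lim (\<lambda>n. picard x y v K b1 b2 n t)"

lemma continuous_on_picard:
  assumes "continuous_on {0..\<tau>} b1" "continuous_on {0..\<tau>} b2"
  shows "continuous_on {0..\<tau>} (picard x y v K b1 b2 n)"
  by (induction n) (auto intro!: continuous_on_barrier_map assms)

text \<open>Consecutive iterates differ by at most a multiple of \<open>(1/2) ^ n\<close> on \<open>[0,\<tau>]\<close>, so the telescoping
  series converges by the Weierstrass test.\<close>

lemma picard_uniform_limit:
  assumes K: "K > 0" and b: "continuous_on {0..\<tau>} b1" "continuous_on {0..\<tau>} b2"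
  shows "uniform_limit {0..\<tau>} (picard x y v K b1 b2) (barrier x y v K b1 b2) sequentially"
proof -
  define P where "P = picard x y v K b1 b2"
  have contP: "continuous_on {0..\<tau>} (P n)" for n
    unfolding P_def by (intro continuous_on_picard b)
  have PSuc: "P (Suc n) = barrier_map x y v K b1 b2 (P n)" for n
    by (simp add: P_def)
  obtain C where C: "\<And>s. s \<in> {0..\<tau>} \<Longrightarrow> \<bar>P 1 s - P 0 s\<bar> \<le> C * exp (4 * K * s)"
    using exp_weighted_bound[OF K, of \<tau> "\<lambda>s. P 1 s - P 0 s"] contP by (auto intro: continuous_intros)
  have bound: "\<forall>s\<in>{0..\<tau>}. \<bar>P (Suc n) s - P n s\<bar> \<le> (C * (1/2)^n) * exp (4 * K * s)" for n
  proof (induction n)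
    case (Suc n)
    show ?case
    proof
      fix s assume s: "s \<in> {0..\<tau>}"
      have "\<bar>barrier_map x y v K b1 b2 (P (Suc n)) s - barrier_map x y v K b1 b2 (P n) s\<bar>
          \<le> (C * (1/2)^n) / 2 * exp (4 * K * s)"
        using Suc by (intro barrier_map_contraction[OF K s b contP contP]) auto
      then show "\<bar>P (Suc (Suc n)) s - P (Suc n) s\<bar> \<le> (C * (1/2)^Suc n) * exp (4 * K * s)"
        by (simp flip: PSuc)
    qed
  qed (use C in auto)
  have le: "norm (P (Suc n) s - P n s) \<le> (\<bar>C\<bar> * exp (4 * K * \<tau>)) * (1/2)^n" if "s \<in> {0..\<tau>}" for n s
  proof -
    have "\<bar>P (Suc n) s - P n s\<bar> \<le> (C * (1/2)^n) * exp (4 * K * s)" using bound that by blast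
    also have "\<dots> \<le> (\<bar>C\<bar> * (1/2)^n) * exp (4 * K * \<tau>)"
      using that K by (intro mult_mono) auto
    finally show ?thesis by (simp add: mult_ac)
  qed
  have "uniform_limit {0..\<tau>} (\<lambda>n s. \<Sum>i<n. P (Suc i) s - P i s) (\<lambda>s. \<Sum>i. P (Suc i) s - P i s) sequentially"
    using le by (intro Weierstrass_m_test[of _ _ "\<lambda>n. (\<bar>C\<bar> * exp (4 * K * \<tau>)) * (1/2)^n"]
      summable_mult summable_geometric) auto
  then have "uniform_limit {0..\<tau>} (\<lambda>n s. y + (\<Sum>i<n. P (Suc i) s - P i s))
      (\<lambda>s. y + (\<Sum>i. P (Suc i) s - P i s)) sequentially"
    by (intro uniform_limit_intros)
  moreover have "y + (\<Sum>i<n. P (Suc i) s - P i s) = P n s" for n s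
    using sum_lessThan_telescope[of "\<lambda>i. P i s" n] by (simp add: P_def)
  ultimately have lim: "uniform_limit {0..\<tau>} P (\<lambda>s. y + (\<Sum>i. P (Suc i) s - P i s)) sequentially"
    by simp
  have "barrier x y v K b1 b2 s = y + (\<Sum>i. P (Suc i) s - P i s)" if "s \<in> {0..\<tau>}" for s
    using tendsto_uniform_limitI[OF lim that] unfolding barrier_def P_def by (rule limI)
  with lim show ?thesis unfolding P_def by (subst uniform_limit_cong') (auto simp only:)
qed

lemma continuous_on_barrier:
  assumes "K > 0" "continuous_on {0..\<tau>} b1" "continuous_on {0..\<tau>} b2"
  shows "continuous_on {0..\<tau>} (barrier x y v K b1 b2)"
  by (rule uniform_limit_theorem[OF _ picard_uniform_limit[OF assms]])
    (auto intro!: always_eventually continuous_on_picard assms)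

text \<open>The contraction estimate also lets \<open>barrier_map\<close> pass to the uniform limit of the iterates.\<close>

lemma barrier_fixed_point:
  assumes K: "K > 0" and b: "continuous_on {0..\<tau>} b1" "continuous_on {0..\<tau>} b2"
    and t: "t \<in> {0..\<tau>}"
  shows "barrier x y v K b1 b2 t = barrier_map x y v K b1 b2 (barrier x y v K b1 b2) t"
proof -
  define P where "P = picard x y v K b1 b2"
  define Y where "Y = barrier x y v K b1 b2"
  define G where "G = barrier_map x y v K b1 b2"
  have ul: "uniform_limit {0..\<tau>} P Y sequentially"
    unfolding P_def Y_def by (rule picard_uniform_limit[OF K b])
  have cont: "continuous_on {0..\<tau>} (P n)" "continuous_on {0..\<tau>} Y" for n
    unfolding P_def Y_def by (intro continuous_on_picard continuous_on_barrier K b)+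
  have "(\<lambda>n. G (P n) t) \<longlonglongrightarrow> G Y t"
  proof (rule tendstoI)
    fix e :: real assume "0 < e"
    then have e: "0 < e * exp (- (4 * K * t))" by simp
    have "\<forall>\<^sub>F n in sequentially. \<forall>s\<in>{0..\<tau>}. dist (P n s) (Y s) < e * exp (- (4 * K * t))"
      using ul e unfolding uniform_limit_iff by blast
    then show "\<forall>\<^sub>F n in sequentially. dist (G (P n) t) (G Y t) < e"
    proof eventually_elim
      case (elim n)
      have "\<bar>G (P n) t - G Y t\<bar> \<le> (e * exp (- (4 * K * t))) / 2 * exp (4 * K * t)"
        unfolding G_def
      proof (rule barrier_map_contraction[OF K t b cont])
        fix s assume s: "s \<in> {0..\<tau>}"
        have "\<bar>P n s - Y s\<bar> \<le> e * exp (- (4 * K * t)) * 1"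
          using elim s by (auto simp: dist_real_def less_imp_le)
        also have "\<dots> \<le> e * exp (- (4 * K * t)) * exp (4 * K * s)"
          using s K e by (intro mult_left_mono) auto
        finally show "\<bar>P n s - Y s\<bar> \<le> e * exp (- (4 * K * t)) * exp (4 * K * s)" .
      qed
      also have "\<dots> = e / 2" by (simp add: exp_minus)
      also have "\<dots> < e" using \<open>0 < e\<close> by simp
      finally show ?case by (simp add: dist_real_def)
    qed
  qed
  moreover have "(\<lambda>n. P (Suc n) t) \<longlonglongrightarrow> Y t"
    using tendsto_uniform_limitI[OF ul t] by (rule LIMSEQ_Suc)
  ultimately have "Y t = G Y t"
    unfolding P_def G_def by (auto intro: LIMSEQ_unique)
  then show ?thesis by (simp add: Y_def G_def)
qed

section \<open>Stieltjes measures of stopped paths\<close>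

text \<open>The time change behind \<open>clamp_path\<close>: the projection of the line onto \<open>times_upto T\<close>.\<close>

definition clamp_time :: "ereal \<Rightarrow> real \<Rightarrow> real" where
  "clamp_time T s = real_of_ereal (max 0 (min (ereal s) T))"

lemma clamp_path_eq: "clamp_path T l s = l (clamp_time T s)"
  by (simp add: clamp_path_def clamp_time_def)

lemma clamp_time_infinity: "clamp_time \<infinity> s = max 0 s"
  by (simp add: clamp_time_def max_def zero_ereal_def)

lemma clamp_time_ereal: "clamp_time (ereal u) s = max 0 (min s u)"
  by (simp add: clamp_time_def max_def min_def zero_ereal_def)

lemma clamp_time_cases:
  assumes "0 \<le> T"
  obtains "T = \<infinity>" "clamp_time T = (\<lambda>s. max 0 s)"
  | u where "T = ereal u" "0 \<le> u" "clamp_time T = (\<lambda>s. max 0 (min s u))"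
  using assms
  by (cases T) (auto simp: clamp_time_infinity clamp_time_ereal fun_eq_iff)

lemma clamp_time_in: "0 \<le> T \<Longrightarrow> clamp_time T s \<in> times_upto T"
  by (erule clamp_time_cases) (auto simp: times_upto_def)

lemma clamp_time_id: "s \<in> times_upto T \<Longrightarrow> clamp_time T s = s"
  by (cases T) (auto simp: times_upto_def clamp_time_infinity clamp_time_ereal)

lemma clamp_time_mono: "0 \<le> T \<Longrightarrow> r \<le> s \<Longrightarrow> clamp_time T r \<le> clamp_time T s"
  by (erule clamp_time_cases) auto

lemma clamp_time_ge: "0 \<le> T \<Longrightarrow> ereal s \<le> T \<Longrightarrow> s \<le> clamp_time T s"
  by (erule clamp_time_cases) auto

lemma clamp_time_le: "0 \<le> T \<Longrightarrow> 0 \<le> s \<Longrightarrow> clamp_time T s \<le> s"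
  by (erule clamp_time_cases) auto

lemma continuous_on_clamp_time: "0 \<le> T \<Longrightarrow> continuous_on A (clamp_time T)"
  by (erule clamp_time_cases) (auto intro!: continuous_intros)

lemma continuous_on_clamp_path:
  assumes "0 \<le> T" "continuous_on (times_upto T) l"
  shows "continuous_on A (clamp_path T l)"
proof -
  have "continuous_on A (\<lambda>s. l (clamp_time T s))"
    using assms(2) continuous_on_clamp_time[OF assms(1)]
    by (rule continuous_on_compose2) (use clamp_time_in[OF assms(1)] in auto)
  then show ?thesis by (simp add: clamp_path_eq[abs_def])
qed

lemma mono_clamp_path:
  assumes "0 \<le> T" "mono_on (times_upto T) l"
  shows "mono (clamp_path T l)"
  using assms clamp_time_in[OF assms(1)] clamp_time_mono[OF assms(1)]
  by (auto simp: mono_def clamp_path_eq intro!: mono_onD[OF assms(2)])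

lemma emeasure_clamp_path:
  assumes "0 \<le> T" "continuous_on (times_upto T) l" "mono_on (times_upto T) l" "a \<le> b"
  shows "emeasure (interval_measure (clamp_path T l)) {a<..b}
    = ennreal (clamp_path T l b - clamp_path T l a)"
proof (rule emeasure_interval_measure_Ioc[OF \<open>a \<le> b\<close>])
  show "continuous (at_right r) (clamp_path T l)" for r
    using continuous_on_clamp_path[OF assms(1,2), of UNIV]
    by (simp add: continuous_on_eq_continuous_at continuous_at_imp_continuous_at_within)
qed (use monoD[OF mono_clamp_path[OF assms(1,3)]] in auto)

lemma flat_off_imp_constant:
  assumes "0 \<le> T" "continuous_on (times_upto T) l" "mono_on (times_upto T) l"
    and flat: "flat_off (clamp_path T l) S"
    and ab: "a \<in> times_upto T" "b \<in> times_upto T" "a \<le> b" "{a<..b} \<inter> S = {}"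
  shows "l a = l b"
proof -
  let ?M = "interval_measure (clamp_path T l)"
  have "emeasure ?M {a<..b} = (\<integral>\<^sup>+ s. indicator {a<..b} s \<partial>?M)" by simp
  also have "\<dots> \<le> (\<integral>\<^sup>+ s. indicator {s. s \<notin> S} s \<partial>?M)"
    using ab by (intro nn_integral_mono) (auto simp: indicator_def)
  also have "\<dots> = 0" using flat by (simp add: flat_off_def)
  finally have "ennreal (clamp_path T l b - clamp_path T l a) = 0"
    using emeasure_clamp_path[OF assms(1-3) \<open>a \<le> b\<close>] by simp
  then have "l b \<le> l a" using ab by (simp add: clamp_path_eq clamp_time_id ennreal_eq_0_iff)
  moreover have "l a \<le> l b" using assms(3) ab by (intro mono_onD[OF assms(3)])
  ultimately show ?thesis by simp
qed

text \<open>Around each point outside \<open>S\<close> the path is constant on a small interval, which may be taken with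
  rational endpoints. Such an interval has Stieltjes measure \<open>0\<close>, and there are only countably many of
  them, so the complement of \<open>S\<close> is covered by a null set.\<close>

lemma flat_offI:
  assumes "0 \<le> T" "continuous_on (times_upto T) l" "mono_on (times_upto T) l"
    and locally_const: "\<And>s. s \<notin> S \<Longrightarrow>
      \<exists>p q. p < s \<and> s < q \<and> clamp_path T l p = clamp_path T l q"
  shows "flat_off (clamp_path T l) S"
proof -
  let ?F = "clamp_path T l"
  let ?M = "interval_measure ?F"
  have mono: "r \<le> s \<Longrightarrow> ?F r \<le> ?F s" for r s
    using mono_clamp_path[OF assms(1,3)] by (rule monoD)
  define I where "I = {(p, q). p \<in> \<rat> \<and> q \<in> \<rat> \<and> p \<le> q \<and> ?F p = ?F q}"
  have "countable I"
    unfolding I_def by (rule countable_subset[of _ "\<rat> \<times> \<rat>"]) (auto intro: countable_rat)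
  then have "(\<Union>(p, q)\<in>I. {p<..q}) \<in> null_sets ?M"
  proof (rule null_sets_UN')
    fix i assume "i \<in> I"
    then show "(case i of (p, q) \<Rightarrow> {p<..q}) \<in> null_sets ?M"
      using emeasure_clamp_path[OF assms(1-3), of "fst i" "snd i"]
      by (auto simp: I_def null_sets_def)
  qed
  then have "AE s in ?M. s \<notin> (\<Union>(p, q)\<in>I. {p<..q})" by (rule AE_not_in)
  then have "AE s in ?M. s \<in> S"
  proof eventually_elim
    case (elim s)
    show ?case
    proof (rule ccontr)
      assume "s \<notin> S"
      then obtain p q where pq: "p < s" "s < q" "?F p = ?F q" using locally_const by blast
      obtain p' q' where r: "p' \<in> \<rat>" "p < p'" "p' < s" "q' \<in> \<rat>" "s < q'" "q' < q"
        using Rats_dense_in_real[OF pq(1)] Rats_dense_in_real[OF pq(2)] by blast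
      have "?F p' = ?F q'"
        using mono[of p p'] mono[of p' q'] mono[of q' q] pq r by linarith
      then have "(p', q') \<in> I" using r by (simp add: I_def)
      then show False using elim r by force
    qed
  qed
  then have "(\<integral>\<^sup>+ s. indicator {s. s \<notin> S} s \<partial>?M) = (\<integral>\<^sup>+ s. 0 \<partial>?M)"
    by (intro nn_integral_cong_AE) (auto elim!: eventually_mono)
  then show ?thesis by (simp add: flat_off_def)
qed

section \<open>The one-dimensional Skorokhod problem\<close>

text \<open>A regulator dominates the running maximum because it is nondecreasing, nonnegative and dominates
  \<open>g\<close>. If it were larger at time \<open>t\<close>, it would have passed a level \<open>m\<close> strictly above the running
  maximum at some time \<open>s\<close>; from then on it stays above \<open>g\<close>, so flatness forbids any further growth and
  it would still be \<open>m\<close> at time \<open>t\<close>.\<close>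

lemma skorokhod_unique:
  assumes T: "0 \<le> T" "t \<in> times_upto T"
    and l: "continuous_on (times_upto T) l" "mono_on (times_upto T) l" "l 0 = 0"
    and g: "continuous_on {0..t} g" "\<And>s. s \<in> times_upto T \<Longrightarrow> g s \<le> l s"
    and flat: "flat_off (clamp_path T l) {s \<in> times_upto T. g s = l s}"
  shows "l t = running_max g t"
proof (rule antisym)
  have t: "0 \<le> t" using T by (simp add: times_upto_def)
  have sub: "{0..t} \<subseteq> times_upto T"
    using T by (auto simp: times_upto_def intro: order_trans[of _ "ereal t"])
  have mono: "l r \<le> l s" if "0 \<le> r" "r \<le> s" "s \<le> t" for r s
    using that sub by (intro mono_onD[OF l(2)]) auto
  show "running_max g t \<le> l t"
  proof (rule running_max_least[OF t])
    show "0 \<le> l t" using t mono[of 0 t] l(3) by simp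
    fix s assume s: "s \<in> {0..t}"
    then have "g s \<le> l s" using sub by (intro g(2)) auto
    also have "l s \<le> l t" using s by (intro mono) auto
    finally show "g s \<le> l t" .
  qed
  show "l t \<le> running_max g t"
  proof (rule ccontr)
    assume "\<not> ?thesis"
    then have "running_max g t < l t" by simp
    then obtain m where m: "running_max g t < m" "m < l t"
      using dense by blast
    \<comment> \<open>Any time at level \<open>m\<close> will do: monotonicity keeps \<open>l\<close> at or above \<open>m\<close> afterwards.\<close>
    have "\<exists>s\<ge>0. s \<le> t \<and> l s = m"
      using m running_max_upper(2)[OF g(1), of 0] t l sub
      by (intro IVT') (auto intro: continuous_on_subset)
    then obtain s where s: "0 \<le> s" "s \<le> t" "l s = m" by blast
    have "{s<..t} \<inter> {s \<in> times_upto T. g s = l s} = {}"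
    proof safe
      fix r assume r: "r \<in> {s<..t}" "g r = l r"
      have "g r \<le> running_max g t" using r s by (intro running_max_upper(1)[OF g(1)]) auto
      then show "r \<in> {}" using mono[of s r] r s m by auto
    qed
    then have "l s = l t"
      using s t sub by (intro flat_off_imp_constant[OF T(1) l(1,2) flat]) auto
    then show False using s m by simp
  qed
qed

lemma continuous_on_halfline:
  fixes f :: "real \<Rightarrow> real"
  assumes "\<And>u. continuous_on {0..u} f"
  shows "continuous_on {0..} f"
  unfolding continuous_on_iff
proof (intro ballI allI impI)
  fix s e :: real assume s: "s \<in> {0..}" and "0 < e"
  then obtain d where "d > 0" "\<And>r. r \<in> {0..s+1} \<Longrightarrow> dist r s < d \<Longrightarrow> dist (f r) (f s) < e"
    using assms[of "s+1"] unfolding continuous_on_iff by force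
  then show "\<exists>d>0. \<forall>r\<in>{0..}. dist r s < d \<longrightarrow> dist (f r) (f s) < e"
    by (intro exI[of _ "min d 1"]) (auto simp: dist_real_def)
qed

lemma times_upto_subset: "times_upto T \<subseteq> {0..}"
  by (auto simp: times_upto_def)

lemma continuous_on_running_max_halfline:
  assumes "continuous_on {0..} g"
  shows "continuous_on {0..} (running_max g)"
  by (intro continuous_on_halfline continuous_on_running_max continuous_on_subset[OF assms]) auto

text \<open>For flatness, consider a time at which \<open>g\<close> is below its running maximum. By continuity a constant
  separates the two on a whole neighbourhood, so no new maximum is reached there. To the left of \<open>0\<close>
  and to the right of \<open>T\<close> the clamped path is constant by construction.\<close>

lemma skorokhod_exists:
  assumes g: "continuous_on {0..} g" "g 0 \<le> 0" and T: "0 \<le> T"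
  shows "continuous_on (times_upto T) (running_max g)"
    and "mono_on (times_upto T) (running_max g)"
    and "running_max g 0 = 0"
    and "flat_off (clamp_path T (running_max g)) {s \<in> times_upto T. g s = running_max g s}"
proof -
  have gsub: "continuous_on {0..u} g" for u using g(1) by (rule continuous_on_subset) auto
  show c: "continuous_on (times_upto T) (running_max g)"
    using continuous_on_running_max_halfline[OF g(1)] times_upto_subset by (rule continuous_on_subset)
  show m: "mono_on (times_upto T) (running_max g)"
    by (auto intro!: mono_onI running_max_mono gsub simp: times_upto_def)
  show "running_max g 0 = 0" using g(2) by (rule running_max_start)
  define F where "F = clamp_path T (running_max g)"
  show "flat_off (clamp_path T (running_max g)) {s \<in> times_upto T. g s = running_max g s}"
  proof (rule flat_offI[OF T c m])
    fix s assume s: "s \<notin> {s \<in> times_upto T. g s = running_max g s}"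
    consider "s < 0" | u where "T = ereal u" "u < s"
      | "s \<in> times_upto T" "g s \<noteq> running_max g s"
      using s T by (cases T) (force simp: times_upto_def)+
    then show "\<exists>p q. p < s \<and> s < q \<and>
        clamp_path T (running_max g) p = clamp_path T (running_max g) q"
    proof cases
      case 1
      then have "clamp_time T r = 0" if "r \<le> 0" for r
        using that by (cases rule: clamp_time_cases[OF T]) auto
      then show ?thesis using 1
        by (intro exI[of _ "s - 1"] exI[of _ "s / 2"]) (auto simp: clamp_path_eq)
    next
      case 2
      then have "clamp_time T r = u" if "u \<le> r" for r
        using that T by (auto simp: clamp_time_ereal)
      then show ?thesis using 2
        by (intro exI[of _ "(s + u) / 2"] exI[of _ "s + 1"]) (auto simp: clamp_path_eq)
    next
      case 3
      then have s0: "0 \<le> s" "ereal s \<le> T" by (auto simp: times_upto_def)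
      have "g s \<le> running_max g s" using s0 by (intro running_max_upper(1) gsub) auto
      with 3 have "g s < running_max g s" by simp
      then obtain c where c: "g s < c" "c < running_max g s" using dense by blast
      have "continuous_on UNIV (clamp_path T g)" "continuous_on UNIV F"
        unfolding F_def
        by (intro continuous_on_clamp_path T \<open>continuous_on (times_upto T) (running_max g)\<close>
            continuous_on_subset[OF g(1) times_upto_subset])+
      then have "(clamp_path T g \<longlongrightarrow> clamp_path T g s) (at s)" "(F \<longlongrightarrow> F s) (at s)"
        by (simp_all add: continuous_on_eq_continuous_at isCont_def)
      moreover have "clamp_path T g s < c" "c < F s"
        using c 3 by (auto simp: F_def clamp_path_eq clamp_time_id)
      ultimately have "\<forall>\<^sub>F r in at s. clamp_path T g r < c \<and> c < F r"
        by (auto intro: eventually_conj order_tendstoD)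
      then obtain d where d: "d > 0"
        "\<And>r. r \<noteq> s \<Longrightarrow> dist r s < d \<Longrightarrow> clamp_path T g r < c \<and> c < F r"
        unfolding eventually_at by auto
      have near: "clamp_path T g r < c \<and> c < F r" if "dist r s < d" for r
        using d(2)[OF _ that] \<open>clamp_path T g s < c\<close> \<open>c < F s\<close> by (cases "r = s") auto
      define p q where "p = s - d/2" and "q = s + d/2"
      have pq: "p < s" "s < q" "dist p s < d" using d(1) by (auto simp: p_def q_def dist_real_def)
      have "ereal p \<le> T" using s0 pq by (auto intro: order_trans[of _ "ereal s" T])
      then have lo: "p \<le> clamp_time T p" using T by (intro clamp_time_ge)
      have hi: "clamp_time T q \<le> q" using T s0 pq by (intro clamp_time_le) auto
      have pos: "0 \<le> clamp_time T p" using clamp_time_in[OF T] by (simp add: times_upto_def)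
      have le: "clamp_time T p \<le> clamp_time T q" using T pq by (intro clamp_time_mono) auto
      have "F q \<le> F p"
        unfolding F_def clamp_path_eq
      proof (rule running_max_increment[OF gsub pos le order_refl])
        fix r assume r: "r \<in> {clamp_time T p..clamp_time T q}"
        then have "ereal r \<le> ereal (clamp_time T q)" by simp
        also have "\<dots> \<le> T" using clamp_time_in[OF T] by (simp add: times_upto_def)
        finally have "r \<in> times_upto T" using r pos by (simp add: times_upto_def)
        moreover have "dist r s < d" using r lo hi d(1) by (auto simp: p_def q_def dist_real_def)
        ultimately have "g r < c" using near[of r] by (simp add: clamp_path_eq clamp_time_id)
        also have "c < F p" using near pq by blast
        finally show "g r \<le> running_max g (clamp_time T p)" by (simp add: F_def clamp_path_eq)
      qed
      moreover have "F p \<le> F q"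
        using pq unfolding F_def by (intro monoD[OF mono_clamp_path[OF T m]]) simp
      ultimately have "F p = F q" by simp
      then show ?thesis using pq unfolding F_def by blast
    qed
  qed
qed

section \<open>The first zero of a path\<close>

definition first_zero :: "(real \<Rightarrow> real) \<Rightarrow> ereal" where
  "first_zero f = (if \<exists>t\<ge>0. f t = 0 then ereal (Inf {t. 0 \<le> t \<and> f t = 0}) else \<infinity>)"

lemma first_zero_cases:
  assumes "continuous_on {0..} f"
  obtains "first_zero f = \<infinity>" "\<And>t. 0 \<le> t \<Longrightarrow> f t \<noteq> 0"
  | u where "first_zero f = ereal u" "0 \<le> u" "f u = 0" "\<And>t. 0 \<le> t \<Longrightarrow> f t = 0 \<Longrightarrow> u \<le> t"
proof (cases "\<exists>t\<ge>0. f t = 0")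
  case True
  let ?Z = "{t. 0 \<le> t \<and> f t = 0}"
  have "closed {t \<in> {0..}. f t = 0}"
    using assms by (intro continuous_closed_preimage_constant) auto
  then have "closed ?Z" by simp
  moreover have bdd: "bdd_below ?Z" by (rule bdd_belowI[of _ 0]) auto
  ultimately have "Inf ?Z \<in> ?Z" using True by (intro closed_contains_Inf) auto
  moreover have "Inf ?Z \<le> t" if "0 \<le> t" "f t = 0" for t
    using that bdd by (intro cInf_lower) auto
  ultimately show ?thesis using True that(2)[of "Inf ?Z"] by (auto simp: first_zero_def)
qed (use that(1) in \<open>auto simp: first_zero_def\<close>)

lemma first_zero_eq_Inf:
  assumes "continuous_on {0..} f"
  shows "first_zero f = Inf (ereal ` {t \<in> times_upto (first_zero f). f t = 0})"
  using assms
proof (cases rule: first_zero_cases)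
  case 1
  then have e: "{t \<in> times_upto (first_zero f). f t = 0} = {}" by (auto simp: times_upto_def)
  show ?thesis by (subst e) (simp add: 1(1) top_ereal_def)
next
  case (2 u)
  then have e: "{t \<in> times_upto (first_zero f). f t = 0} = {u}"
    by (auto simp: times_upto_def intro: antisym)
  show ?thesis by (subst e) (simp add: 2(1))
qed

lemma first_zero_nonneg: "continuous_on {0..} f \<Longrightarrow> 0 \<le> first_zero f"
  by (erule first_zero_cases) auto

lemma first_zero_le_iff:
  assumes "continuous_on {0..} f"
  shows "first_zero f \<le> ereal a \<longleftrightarrow> (\<exists>t\<in>{0..a}. f t = 0)"
  using assms
proof (cases rule: first_zero_cases)
  case (2 u)
  then show ?thesis by (auto intro: bexI[of _ u] order_trans[OF 2(4)])
qed auto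

section \<open>Pathwise existence and uniqueness\<close>

text \<open>Reading the conditions as a pair of Skorokhod problems, driven by \<open>b1 - Y\<close> and \<open>Y - (x + b2)\<close>.\<close>

lemma inert_path_system_iff:
  "inert_path_system x y v K b1 b2 l1 l2 T \<longleftrightarrow>
     (let Y = path_Y y v K l1 l2 in
       (\<forall>t\<in>times_upto T. b1 t - Y t \<le> l1 t \<and> Y t - (x + b2 t) \<le> l2 t) \<and>
       continuous_on (times_upto T) l1 \<and> mono_on (times_upto T) l1 \<and> l1 0 = 0 \<and>
       continuous_on (times_upto T) l2 \<and> mono_on (times_upto T) l2 \<and> l2 0 = 0 \<and>
       flat_off (clamp_path T l1) {t \<in> times_upto T. b1 t - Y t = l1 t} \<and>
       flat_off (clamp_path T l2) {t \<in> times_upto T. Y t - (x + b2 t) = l2 t} \<and>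
       T = Inf (ereal ` {t \<in> times_upto T. path_X2 x b2 l2 t - path_X1 b1 l1 t = 0}))"
proof -
  have "(b1 t - l1 t \<le> Y \<and> Y \<le> x + b2 t + l2 t) = (b1 t - Y \<le> l1 t \<and> Y - (x + b2 t) \<le> l2 t)"
    "(b1 t - l1 t = Y) = (b1 t - Y = l1 t)" "(x + b2 t + l2 t = Y) = (Y - (x + b2 t) = l2 t)"
    "(b1 t - l1 t = x + b2 t + l2 t) = (x + b2 t + l2 t - (b1 t - l1 t) = 0)" for t Y
    by auto
  then show ?thesis
    by (simp add: inert_path_system_def path_X1_def path_X2_def Let_def)
qed

lemma inert_path_system_nonneg:
  assumes "inert_path_system x y v K b1 b2 l1 l2 T"
  shows "0 \<le> T"
proof -
  have "T = Inf (ereal ` {t \<in> times_upto T. path_X2 x b2 l2 t - path_X1 b1 l1 t = 0})"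
    using assms unfolding inert_path_system_iff Let_def by blast
  also have "0 \<le> \<dots>" by (auto intro!: Inf_greatest simp: times_upto_def)
  finally show ?thesis .
qed

lemma inert_path_system_running_max:
  assumes sys: "inert_path_system x y v K b1 b2 l1 l2 T"
    and b: "continuous_on {0..} b1" "continuous_on {0..} b2"
    and t: "t \<in> times_upto T"
  defines "Y \<equiv> path_Y y v K l1 l2"
  shows "l1 t = running_max (\<lambda>s. b1 s - Y s) t" "l2 t = running_max (\<lambda>s. Y s - (x + b2 s)) t"
    and "Y t = barrier_map x y v K b1 b2 Y t" "continuous_on {0..t} Y"
proof -
  have l1: "continuous_on (times_upto T) l1" "mono_on (times_upto T) l1" "l1 0 = 0"
      "\<And>s. s \<in> times_upto T \<Longrightarrow> b1 s - Y s \<le> l1 s"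
      "flat_off (clamp_path T l1) {s \<in> times_upto T. b1 s - Y s = l1 s}"
    and l2: "continuous_on (times_upto T) l2" "mono_on (times_upto T) l2" "l2 0 = 0"
      "\<And>s. s \<in> times_upto T \<Longrightarrow> Y s - (x + b2 s) \<le> l2 s"
      "flat_off (clamp_path T l2) {s \<in> times_upto T. Y s - (x + b2 s) = l2 s}"
    using sys unfolding inert_path_system_iff Let_def Y_def by blast+
  have sub: "{0..s} \<subseteq> times_upto T" if "s \<in> times_upto T" for s
    using that by (auto simp: times_upto_def intro: order_trans[of _ "ereal s"])
  have contY: "continuous_on {0..s} Y" if "s \<in> times_upto T" for s
    unfolding Y_def using l1(1) l2(1) sub[OF that]
    by (intro continuous_on_path_Y) (auto intro: continuous_on_subset)
  have bs: "continuous_on {0..s} b1" "continuous_on {0..s} b2" for s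
    using b by (auto intro: continuous_on_subset)
  note T = inert_path_system_nonneg[OF sys]
  have eq: "l1 s = running_max (\<lambda>s. b1 s - Y s) s" "l2 s = running_max (\<lambda>s. Y s - (x + b2 s)) s"
    if "s \<in> times_upto T" for s
  proof -
    show "l1 s = running_max (\<lambda>s. b1 s - Y s) s"
      by (rule skorokhod_unique[OF T that l1(1-3) _ l1(4,5)]) (intro continuous_intros bs contY that)
    show "l2 s = running_max (\<lambda>s. Y s - (x + b2 s)) s"
      by (rule skorokhod_unique[OF T that l2(1-3) _ l2(4,5)]) (intro continuous_intros bs contY that)
  qed
  show "l1 t = running_max (\<lambda>s. b1 s - Y s) t" "l2 t = running_max (\<lambda>s. Y s - (x + b2 s)) t"
    using eq t by auto
  show "continuous_on {0..t} Y" using contY t .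
  have "path_Y y v K l1 l2 t = barrier_map x y v K b1 b2 Y t"
    unfolding barrier_map_def using eq sub[OF t] by (intro path_Y_cong) auto
  then show "Y t = barrier_map x y v K b1 b2 Y t" unfolding Y_def .
qed

text \<open>On \<open>[0,t]\<close> both barriers are fixed points of the same contraction, hence equal, and the regulators
  are determined by the barrier.\<close>

lemma inert_path_system_agree:
  assumes sys: "inert_path_system x y v K b1 b2 l1 l2 T" "inert_path_system x y v K b1 b2 l1' l2' T'"
    and b: "continuous_on {0..} b1" "continuous_on {0..} b2" and K: "K > 0"
    and t: "t \<in> times_upto T" "t \<in> times_upto T'"
  shows "l1' t = l1 t \<and> l2' t = l2 t"
proof -
  define Y Z where "Y = path_Y y v K l1 l2" and "Z = path_Y y v K l1' l2'"
  note Y = inert_path_system_running_max[OF sys(1) b, folded Y_def]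
  note Z = inert_path_system_running_max[OF sys(2) b, folded Z_def]
  have sub: "s \<in> times_upto T \<and> s \<in> times_upto T'" if "s \<in> {0..t}" for s
    using that t by (auto simp: times_upto_def intro: order_trans[of _ "ereal t"])
  have fixed: "Y s = barrier_map x y v K b1 b2 Y s" "Z s = barrier_map x y v K b1 b2 Z s"
    if "s \<in> {0..t}" for s
    using Y(3) Z(3) sub[OF that] by blast+
  have cont: "continuous_on {0..t} b1" "continuous_on {0..t} b2"
    using b by (auto intro: continuous_on_subset)
  have eq: "Y s = Z s" if "s \<in> {0..t}" for s
    by (rule barrier_unique[OF K cont Y(4)[OF t(1)] Z(4)[OF t(2)] fixed that])
  have "running_max (\<lambda>s. b1 s - Z s) t = running_max (\<lambda>s. b1 s - Y s) t"
    "running_max (\<lambda>s. Z s - (x + b2 s)) t = running_max (\<lambda>s. Y s - (x + b2 s)) t"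
    by (rule running_max_cong, simp add: eq)+
  then show ?thesis
    by (simp only: Y(1,2)[OF t(1)] Z(1,2)[OF t(2)])
qed

text \<open>If \<open>T\<close> is less than \<open>T'\<close>, it is finite and so the infimum of a nonempty set. A meeting time of the
  first solution lies in the domain of the second one, where both agree; so the second pair of
  paths meets there too, and \<open>T'\<close> cannot be larger.\<close>

lemma inert_path_system_time_le:
  assumes sys: "inert_path_system x y v K b1 b2 l1 l2 T" "inert_path_system x y v K b1 b2 l1' l2' T'"
    and b: "continuous_on {0..} b1" "continuous_on {0..} b2" and K: "K > 0"
  shows "T' \<le> T"
proof (rule ccontr)
  assume "\<not> T' \<le> T"
  then have less: "T < T'" by simp
  let ?A = "{t \<in> times_upto T. path_X2 x b2 l2 t - path_X1 b1 l1 t = 0}"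
  let ?A' = "{t \<in> times_upto T'. path_X2 x b2 l2' t - path_X1 b1 l1' t = 0}"
  have T: "T = Inf (ereal ` ?A)" and T': "T' = Inf (ereal ` ?A')"
    using sys unfolding inert_path_system_iff Let_def by blast+
  have "?A \<noteq> {}"
  proof
    assume "?A = {}"
    then have "Inf (ereal ` ?A) = \<infinity>" by (simp only: image_empty Inf_empty top_ereal_def)
    with T have "T = \<infinity>" by (rule trans)
    then show False using less by simp
  qed
  then obtain t where t: "t \<in> ?A" by blast
  then have "ereal t \<le> T" by (simp add: times_upto_def)
  then have t': "t \<in> times_upto T'" using t less by (simp add: times_upto_def)
  with t have "t \<in> ?A'"
    using inert_path_system_agree[OF sys b K, of t] by (simp add: path_X1_def path_X2_def)
  then have "Inf (ereal ` ?A') \<le> ereal t" by (intro Inf_lower imageI)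
  with T' have "T' \<le> ereal t" by (rule ord_eq_le_trans)
  then show False using \<open>ereal t \<le> T\<close> less by simp
qed

definition lower_regulator where
  "lower_regulator x y v K b1 b2 = running_max (\<lambda>s. b1 s - barrier x y v K b1 b2 s)"

definition upper_regulator where
  "upper_regulator x y v K b1 b2 = running_max (\<lambda>s. barrier x y v K b1 b2 s - (x + b2 s))"

definition gap where
  "gap x y v K b1 b2 t = path_X2 x b2 (upper_regulator x y v K b1 b2) t
     - path_X1 b1 (lower_regulator x y v K b1 b2) t"

text \<open>What is needed to apply \<open>skorokhod_exists\<close> to both regulators of the fixed point.\<close>

lemma regulators_admissible:
  fixes v :: real
  assumes b: "continuous_on {0..} b1" "continuous_on {0..} b2" "b1 0 = 0" "b2 0 = 0"
    and "0 \<le> y" "y \<le> x" and K: "K > 0"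
  defines "Y \<equiv> barrier x y v K b1 b2"
  shows "continuous_on {0..} (\<lambda>s. b1 s - Y s)" "continuous_on {0..} (\<lambda>s. Y s - (x + b2 s))"
    and "b1 0 - Y 0 \<le> 0" "Y 0 - (x + b2 0) \<le> 0"
    and "continuous_on {0..} (gap x y v K b1 b2)"
    and "\<And>t. 0 \<le> t \<Longrightarrow> 
      path_Y y v K (lower_regulator x y v K b1 b2) (upper_regulator x y v K b1 b2) t = Y t"
proof -
  have bs: "continuous_on {0..s} b1" "continuous_on {0..s} b2" for s
    using b by (auto intro: continuous_on_subset)
  have Y: "continuous_on {0..} Y"
    unfolding Y_def by (intro continuous_on_halfline continuous_on_barrier K bs)
  show c: "continuous_on {0..} (\<lambda>s. b1 s - Y s)" "continuous_on {0..} (\<lambda>s. Y s - (x + b2 s))"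
    by (intro continuous_intros b Y)+
  show "continuous_on {0..} (gap x y v K b1 b2)"
    unfolding gap_def[abs_def] path_X1_def path_X2_def lower_regulator_def upper_regulator_def
    by (intro continuous_intros b continuous_on_running_max_halfline c[unfolded Y_def])
  show fixed: "path_Y y v K (lower_regulator x y v K b1 b2) (upper_regulator x y v K b1 b2) t = Y t"
    if "0 \<le> t" for t
    using barrier_fixed_point[OF K bs, of t t x y v] that
    by (simp add: Y_def barrier_map_def lower_regulator_def upper_regulator_def)
  have "Y 0 = y" using fixed[of 0] by (simp add: path_Y_def)
  then show "b1 0 - Y 0 \<le> 0" "Y 0 - (x + b2 0) \<le> 0" using assms by auto
qed

lemma inert_path_system_exists:
  assumes b: "continuous_on {0..} b1" "continuous_on {0..} b2" "b1 0 = 0" "b2 0 = 0"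
    and xy: "0 \<le> y" "y \<le> x" and K: "K > 0"
  shows "inert_path_system x y v K b1 b2 (lower_regulator x y v K b1 b2)
    (upper_regulator x y v K b1 b2) (first_zero (gap x y v K b1 b2))"
proof -
  define Y where "Y = barrier x y v K b1 b2"
  define l1 where "l1 = lower_regulator x y v K b1 b2"
  define l2 where "l2 = upper_regulator x y v K b1 b2"
  define T where "T = first_zero (gap x y v K b1 b2)"
  note r = regulators_admissible[where v = v, OF b xy K, folded Y_def l1_def l2_def]
  have l: "l1 = running_max (\<lambda>s. b1 s - Y s)" "l2 = running_max (\<lambda>s. Y s - (x + b2 s))"
    by (simp_all add: l1_def l2_def lower_regulator_def upper_regulator_def Y_def)
  have T: "0 \<le> T" unfolding T_def by (rule first_zero_nonneg[OF r(5)])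
  have YY: "path_Y y v K l1 l2 t = Y t" if "t \<in> times_upto T" for t
    using r(6) that by (simp add: times_upto_def)
  have eqs: "{t \<in> times_upto T. b1 t - path_Y y v K l1 l2 t = l1 t} = {t \<in> times_upto T. b1 t - Y t = l1 t}"
    "{t \<in> times_upto T. path_Y y v K l1 l2 t - (x + b2 t) = l2 t} = {t \<in> times_upto T. Y t - (x + b2 t) = l2 t}"
    using YY by auto
  have le: "b1 t - Y t \<le> l1 t" "Y t - (x + b2 t) \<le> l2 t" if "t \<in> times_upto T" for t
  proof -
    have "0 \<le> t" using that by (simp add: times_upto_def)
    then show "b1 t - Y t \<le> l1 t" "Y t - (x + b2 t) \<le> l2 t"
      using running_max_upper(1)[OF continuous_on_subset[OF r(1)], of t t]
        running_max_upper(1)[OF continuous_on_subset[OF r(2)], of t t]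
      by (auto simp: l)
  qed
  have inf: "T = Inf (ereal ` {t \<in> times_upto T. path_X2 x b2 l2 t - path_X1 b1 l1 t = 0})"
    using first_zero_eq_Inf[OF r(5)] unfolding T_def l1_def l2_def gap_def .
  show ?thesis
    unfolding inert_path_system_iff Let_def
    unfolding T_def[symmetric] l1_def[symmetric] l2_def[symmetric] eqs
    using skorokhod_exists[OF r(1,3) T, folded l] skorokhod_exists[OF r(2,4) T, folded l]
    by (intro conjI inf ballI) (simp_all add: le YY)
qed

section \<open>Measurability in the sample point\<close>

text \<open>By continuity it suffices to test the bound \<open>running_max \<le> a\<close> at rational times and at the
  endpoints.\<close>

lemma running_max_measurable:
  fixes h :: "real \<Rightarrow> 'a \<Rightarrow> real"
  assumes meas: "\<And>s. 0 \<le> s \<Longrightarrow> h s \<in> borel_measurable M"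
    and cont: "\<And>\<omega>. \<omega> \<in> space M \<Longrightarrow> continuous_on {0..} (\<lambda>s. h s \<omega>)" and t: "0 \<le> t"
  shows "(\<lambda>\<omega>. running_max (\<lambda>s. h s \<omega>) t) \<in> borel_measurable M"
proof (rule borel_measurableI_le)
  fix a :: real
  have iff: "running_max (\<lambda>s. h s \<omega>) t \<le> a \<longleftrightarrow> 0 \<le> a \<and> (\<forall>q\<in>\<rat> \<inter> {0<..<t} \<union> {0, t}. h q \<omega> \<le> a)"
    if \<omega>: "\<omega> \<in> space M" for \<omega>
  proof -
    have c: "continuous_on {0..t} (\<lambda>s. h s \<omega>)"
      using cont[OF \<omega>] by (rule continuous_on_subset) auto
    show ?thesis
    proof (intro iffI conjI ballI)
      assume le: "running_max (\<lambda>s. h s \<omega>) t \<le> a"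
      then show "0 \<le> a" using running_max_upper(2)[OF c, of 0] t by auto
      show "h q \<omega> \<le> a" if "q \<in> \<rat> \<inter> {0<..<t} \<union> {0, t}" for q
        using running_max_upper(1)[OF c, of q] le that t by auto
    next
      assume a: "0 \<le> a \<and> (\<forall>q\<in>\<rat> \<inter> {0<..<t} \<union> {0, t}. h q \<omega> \<le> a)"
      show "running_max (\<lambda>s. h s \<omega>) t \<le> a"
      proof (rule running_max_least[OF t], use a in simp)
        fix s assume s: "s \<in> {0..t}"
        show "h s \<omega> \<le> a"
        proof (rule ccontr)
          assume gt: "\<not> h s \<omega> \<le> a"
          then have s': "s \<in> {0<..<t}" using a s by (cases "s = 0 \<or> s = t") auto
          have "isCont (\<lambda>s. h s \<omega>) s"
            using c s' by (intro continuous_on_interior[of "{0..t}"]) auto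
          then have "\<forall>\<^sub>F r in at s. a < h r \<omega>"
            using gt by (intro order_tendstoD) (auto simp: isCont_def)
          then obtain d where d: "d > 0" "\<And>r. r \<noteq> s \<Longrightarrow> dist r s < d \<Longrightarrow> a < h r \<omega>"
            unfolding eventually_at by auto
          obtain q where q: "q \<in> \<rat>" "s < q" "q < min t (s + d)"
            using Rats_dense_in_real[of s "min t (s + d)"] s' d(1) by auto
          have "h q \<omega> \<le> a" using a q s' by auto
          moreover have "a < h q \<omega>" using q by (intro d) (auto simp: dist_real_def)
          ultimately show False by simp
        qed
      qed
    qed
  qed
  have "countable (\<rat> \<inter> {0<..<t} \<union> {0, t})" by (simp add: countable_rat)
  moreover have "h q \<in> borel_measurable M" if "q \<in> \<rat> \<inter> {0<..<t} \<union> {0, t}" for q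
    using that t by (intro meas) auto
  ultimately have "{\<omega> \<in> space M. 0 \<le> a \<and> (\<forall>q\<in>\<rat> \<inter> {0<..<t} \<union> {0, t}. h q \<omega> \<le> a)} \<in> sets M"
    by (intro sets.sets_Collect_conj sets.sets_Collect_const sets.sets_Collect_countable_Ball)
      (auto intro: borel_measurable_le)
  also have "{\<omega> \<in> space M. 0 \<le> a \<and> (\<forall>q\<in>\<rat> \<inter> {0<..<t} \<union> {0, t}. h q \<omega> \<le> a)}
      = {\<omega> \<in> space M. running_max (\<lambda>s. h s \<omega>) t \<le> a}" using iff by auto
  finally show "{\<omega> \<in> space M. running_max (\<lambda>s. h s \<omega>) t \<le> a} \<in> sets M" .
qed

text \<open>A function of \<open>(\<omega>, s)\<close> that is measurable in \<open>\<omega>\<close> and continuous in \<open>s\<close> is jointly measurable, as the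
  limit of its discretisations in \<open>s\<close>; then Fubini's theorem applies.\<close>

lemma integral_measurable:
  fixes h :: "real \<Rightarrow> 'a \<Rightarrow> real"
  assumes meas: "\<And>s. 0 \<le> s \<Longrightarrow> h s \<in> borel_measurable M"
    and cont: "\<And>\<omega>. \<omega> \<in> space M \<Longrightarrow> continuous_on {0..} (\<lambda>s. h s \<omega>)"
  shows "(\<lambda>\<omega>. integral {0..t} (\<lambda>s. h s \<omega>)) \<in> borel_measurable M"
proof -
  \<comment> \<open>The largest multiple of \<open>1 / (n + 1)\<close> that is at most \<open>s\<close>; it takes countably many values.\<close>
  define k where "k n s = of_int \<lfloor>real (Suc n) * s\<rfloor> / real (Suc n)" for n s
  have k_lim: "(\<lambda>n. k n s) \<longlonglongrightarrow> s" for s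
  proof (rule LIMSEQ_I)
    fix e :: real assume "0 < e"
    then obtain N where N: "inverse (real (Suc N)) < e" using reals_Archimedean by blast
    have "norm (k n s - s) < e" if "N \<le> n" for n
    proof -
      have "norm (k n s - s) \<le> inverse (real (Suc n))"
      proof -
        have "k n s - s = (of_int \<lfloor>real (Suc n) * s\<rfloor> - real (Suc n) * s) / real (Suc n)"
          by (simp add: k_def divide_simps)
        moreover have "\<bar>of_int \<lfloor>real (Suc n) * s\<rfloor> - real (Suc n) * s\<bar> \<le> 1" by linarith
        ultimately show ?thesis by (simp add: inverse_eq_divide divide_right_mono)
      qed
      also have "\<dots> \<le> inverse (real (Suc N))" using that by (intro le_imp_inverse_le) auto
      finally show ?thesis using N by simp
    qed
    then show "\<exists>N. \<forall>n\<ge>N. norm (k n s - s) < e" by blast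
  qed
  have k_pos: "0 \<le> k n s" if "0 \<le> s" for n s using that by (simp add: k_def)
  define H where "H s \<omega> = indicator {0..t} s * h s \<omega>" for s \<omega>
  \<comment> \<open>The maximum with \<open>0\<close> only serves to keep the discretised time in the domain where \<open>h\<close> is measurable.\<close>
  define Hn where "Hn n s \<omega> = indicator {0..t} s * h (max 0 (k n s)) \<omega>" for n s \<omega>
  have "(\<lambda>p. H (snd p) (fst p)) \<in> borel_measurable (M \<Otimes>\<^sub>M lborel)"
  proof (rule borel_measurable_LIMSEQ_real[where u = "\<lambda>n p. Hn n (snd p) (fst p)"])
    fix p :: "'a \<times> real" assume p: "p \<in> space (M \<Otimes>\<^sub>M lborel)"
    then have \<omega>: "fst p \<in> space M" by (simp add: space_pair_measure mem_Times_iff)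
    show "(\<lambda>n. Hn n (snd p) (fst p)) \<longlonglongrightarrow> H (snd p) (fst p)"
    proof (cases "snd p \<in> {0..t}")
      case True
      have "(\<lambda>n. h (k n (snd p)) (fst p)) \<longlonglongrightarrow> h (snd p) (fst p)"
        using k_lim k_pos True by (intro continuous_on_tendsto_compose[OF cont[OF \<omega>]]) auto
      then show ?thesis using True k_pos by (simp add: H_def Hn_def max_absorb2)
    qed (simp add: H_def Hn_def)
  next
    fix n
    define A where "A i p = indicator {0..t} (snd p) * h (max 0 (of_int i / real (Suc n))) (fst p)"
      for i :: int and p :: "'a \<times> real"
    have "(\<lambda>p. A \<lfloor>real (Suc n) * snd p\<rfloor> p) \<in> borel_measurable (M \<Otimes>\<^sub>M lborel)"
    proof (rule measurable_compose_countable[where f = A])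
      fix i :: int
      have [measurable]: "h (max 0 (of_int i / real (Suc n))) \<in> borel_measurable M"
        by (rule meas) auto
      show "A i \<in> borel_measurable (M \<Otimes>\<^sub>M lborel)" unfolding A_def by measurable
    qed measurable
    then show "(\<lambda>p. Hn n (snd p) (fst p)) \<in> borel_measurable (M \<Otimes>\<^sub>M lborel)"
      by (simp add: Hn_def k_def A_def)
  qed
  then have "(\<lambda>(\<omega>, s). H s \<omega>) \<in> borel_measurable (M \<Otimes>\<^sub>M lborel)"
    by (simp add: case_prod_beta')
  then have "(\<lambda>\<omega>. \<integral>s. H s \<omega> \<partial>lborel) \<in> borel_measurable M"
    by (rule lborel.borel_measurable_lebesgue_integral)
  moreover have "(\<integral>s. H s \<omega> \<partial>lborel) = integral {0..t} (\<lambda>s. h s \<omega>)" if "\<omega> \<in> space M" for \<omega>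
  proof -
    have "continuous_on {0..t} (\<lambda>s. h s \<omega>)"
      using cont[OF that] by (rule continuous_on_subset) auto
    then have "set_integrable lborel {0..t} (\<lambda>s. h s \<omega>)"
      by (rule borel_integrable_atLeastAtMost')
    from set_borel_integral_eq_integral(2)[OF this] show ?thesis
      by (simp add: H_def set_lebesgue_integral_def)
  qed
  ultimately show ?thesis by (simp cong: measurable_cong)
qed

text \<open>The path has a zero in \<open>[0,r]\<close> exactly if the maximum of \<open>1 - \<bar>f\<bar>\<close> over \<open>[0,r]\<close> is at least \<open>1\<close>,
  which reduces the claim to the measurability of running maxima.\<close>

lemma first_zero_measurable:
  fixes f :: "'a \<Rightarrow> real \<Rightarrow> real"
  assumes meas: "\<And>t. 0 \<le> t \<Longrightarrow> (\<lambda>\<omega>. f \<omega> t) \<in> borel_measurable M"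
    and cont: "\<And>\<omega>. \<omega> \<in> space M \<Longrightarrow> continuous_on {0..} (f \<omega>)"
  shows "(\<lambda>\<omega>. first_zero (f \<omega>)) \<in> borel_measurable M"
  unfolding borel_measurable_iff_Iic_ereal
proof
  fix a :: ereal
  define g where "g \<omega> s = 1 - \<bar>f \<omega> s\<bar>" for \<omega> s
  have contg: "continuous_on {0..} (g \<omega>)" if "\<omega> \<in> space M" for \<omega>
    unfolding g_def[abs_def] by (intro continuous_intros cont that)
  have iff: "first_zero (f \<omega>) \<le> ereal r \<longleftrightarrow> 0 \<le> r \<and> 1 \<le> running_max (g \<omega>) r"
    if \<omega>: "\<omega> \<in> space M" for r \<omega>
  proof (cases "0 \<le> r")
    case True
    have c: "continuous_on {0..r} (g \<omega>)" using contg[OF \<omega>] by (rule continuous_on_subset) auto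
    then obtain s where s: "s \<in> {0..r}" "\<And>q. q \<in> {0..r} \<Longrightarrow> g \<omega> q \<le> g \<omega> s"
      using continuous_attains_sup[OF compact_Icc _ c] True by auto
    have "(\<exists>t\<in>{0..r}. f \<omega> t = 0) \<longleftrightarrow> 1 \<le> running_max (g \<omega>) r"
    proof
      assume "\<exists>t\<in>{0..r}. f \<omega> t = 0"
      then obtain t where "t \<in> {0..r}" "f \<omega> t = 0" by blast
      then show "1 \<le> running_max (g \<omega>) r"
        using running_max_upper(1)[OF c, of t] by (simp add: g_def)
    next
      assume "1 \<le> running_max (g \<omega>) r"
      also have "\<dots> \<le> max 0 (g \<omega> s)" using True s(2) by (intro running_max_least) (auto simp: le_max_iff_disj)
      finally have "f \<omega> s = 0" by (simp add: g_def max_def split: if_splits)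
      then show "\<exists>t\<in>{0..r}. f \<omega> t = 0" using s(1) by blast
    qed
    then show ?thesis using first_zero_le_iff[OF cont[OF \<omega>]] True by simp
  qed (use first_zero_le_iff[OF cont[OF \<omega>]] in auto)
  show "(\<lambda>\<omega>. first_zero (f \<omega>)) -` {..a} \<inter> space M \<in> sets M"
  proof (cases a)
    case (real r)
    have "{\<omega> \<in> space M. 0 \<le> r \<and> 1 \<le> running_max (g \<omega>) r} \<in> sets M"
    proof (cases "0 \<le> r")
      case True
      have "(\<lambda>\<omega>. running_max (g \<omega>) r) \<in> borel_measurable M"
        using contg True meas
        by (intro running_max_measurable[of "\<lambda>s \<omega>. g \<omega> s"]) (auto simp: g_def)
      then show ?thesis by measurable
    qed simp
    also have "{\<omega> \<in> space M. 0 \<le> r \<and> 1 \<le> running_max (g \<omega>) r}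
        = (\<lambda>\<omega>. first_zero (f \<omega>)) -` {..a} \<inter> space M"
      using iff real by auto
    finally show ?thesis .
  next
    case MInf
    have "(\<lambda>\<omega>. first_zero (f \<omega>)) -` {..a} \<inter> space M = {}"
      using first_zero_nonneg[OF cont] MInf by fastforce
    then show ?thesis by simp
  next
    case PInf
    then have "(\<lambda>\<omega>. first_zero (f \<omega>)) -` {..a} \<inter> space M = space M" by auto
    then show ?thesis by simp
  qed
qed

text \<open>The iterates are measurable at each time by induction, because \<open>barrier_map\<close> is composed of running
  maxima and an integral; the barrier is their pointwise limit.\<close>

lemma regulators_measurable:
  assumes meas: "\<And>t. 0 \<le> t \<Longrightarrow> B1 t \<in> borel_measurable M" "\<And>t. 0 \<le> t \<Longrightarrow> B2 t \<in> borel_measurable M"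
    and cont: "\<And>\<omega>. \<omega> \<in> space M \<Longrightarrow> continuous_on {0..} (\<lambda>t. B1 t \<omega>)"
      "\<And>\<omega>. \<omega> \<in> space M \<Longrightarrow> continuous_on {0..} (\<lambda>t. B2 t \<omega>)"
    and K: "K > 0" and t: "0 \<le> t"
  shows "(\<lambda>\<omega>. lower_regulator x y v K (\<lambda>t. B1 t \<omega>) (\<lambda>t. B2 t \<omega>) t) \<in> borel_measurable M"
    and "(\<lambda>\<omega>. upper_regulator x y v K (\<lambda>t. B1 t \<omega>) (\<lambda>t. B2 t \<omega>) t) \<in> borel_measurable M"
proof -
  have bs: "continuous_on {0..u} (\<lambda>t. B1 t \<omega>)" "continuous_on {0..u} (\<lambda>t. B2 t \<omega>)"
    if "\<omega> \<in> space M" for \<omega> u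
    using cont[OF that] by (auto intro: continuous_on_subset)
  define P where "P n t \<omega> = picard x y v K (\<lambda>t. B1 t \<omega>) (\<lambda>t. B2 t \<omega>) n t" for n t \<omega>
  have contP: "continuous_on {0..} (\<lambda>t. P n t \<omega>)" if "\<omega> \<in> space M" for n \<omega>
    unfolding P_def by (intro continuous_on_halfline continuous_on_picard bs that)
  have measP: "P n t \<in> borel_measurable M" if "0 \<le> t" for n t
    using that
  proof (induction n arbitrary: t)
    case 0
    then show ?case by (simp add: P_def)
  next
    case (Suc n)
    define R1 where "R1 s \<omega> = running_max (\<lambda>s. B1 s \<omega> - P n s \<omega>) s" for s \<omega>
    define R2 where "R2 s \<omega> = running_max (\<lambda>s. P n s \<omega> - (x + B2 s \<omega>)) s" for s \<omega>
    have "R1 s \<in> borel_measurable M" "R2 s \<in> borel_measurable M" if "0 \<le> s" for s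
    proof -
      show "R1 s \<in> borel_measurable M"
        unfolding R1_def using Suc.IH meas that
        by (intro running_max_measurable) (auto intro!: continuous_intros contP cont)
      show "R2 s \<in> borel_measurable M"
        unfolding R2_def using Suc.IH meas that
        by (intro running_max_measurable) (auto intro!: continuous_intros contP cont)
    qed
    moreover have "continuous_on {0..} (\<lambda>s. R1 s \<omega>)" "continuous_on {0..} (\<lambda>s. R2 s \<omega>)"
      if "\<omega> \<in> space M" for \<omega>
      unfolding R1_def R2_def
      by (intro continuous_on_running_max_halfline continuous_intros contP cont that)+
    ultimately have "(\<lambda>\<omega>. integral {0..t} (\<lambda>s. v + K * (R1 s \<omega> - R2 s \<omega>))) \<in> borel_measurable M"
      by (intro integral_measurable) (auto intro!: continuous_intros)
    then have "(\<lambda>\<omega>. y + integral {0..t} (\<lambda>s. v + K * (R1 s \<omega> - R2 s \<omega>))) \<in> borel_measurable M"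
      by simp
    also have "(\<lambda>\<omega>. y + integral {0..t} (\<lambda>s. v + K * (R1 s \<omega> - R2 s \<omega>))) = P (Suc n) t"
      by (simp add: fun_eq_iff P_def R1_def R2_def barrier_map_def path_Y_def path_V_def[abs_def])
    finally show ?case .
  qed
  define Y where "Y t \<omega> = barrier x y v K (\<lambda>t. B1 t \<omega>) (\<lambda>t. B2 t \<omega>) t" for t \<omega>
  have contY: "continuous_on {0..} (\<lambda>t. Y t \<omega>)" if "\<omega> \<in> space M" for \<omega>
    unfolding Y_def by (intro continuous_on_halfline continuous_on_barrier K bs that)
  have measY: "Y t \<in> borel_measurable M" if "0 \<le> t" for t
  proof (rule borel_measurable_LIMSEQ_real)
    show "P n t \<in> borel_measurable M" for n using that by (rule measP)
    show "(\<lambda>n. P n t \<omega>) \<longlonglongrightarrow> Y t \<omega>" if "\<omega> \<in> space M" for \<omega>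
      unfolding P_def Y_def
      by (rule tendsto_uniform_limitI[OF picard_uniform_limit[OF K bs[OF that, of t]]])
        (use \<open>0 \<le> t\<close> in simp)
  qed
  have "(\<lambda>\<omega>. running_max (\<lambda>s. B1 s \<omega> - Y s \<omega>) t) \<in> borel_measurable M"
    "(\<lambda>\<omega>. running_max (\<lambda>s. Y s \<omega> - (x + B2 s \<omega>)) t) \<in> borel_measurable M"
    using measY meas t
    by (intro running_max_measurable; auto intro!: continuous_intros contY cont)+
  then show "(\<lambda>\<omega>. lower_regulator x y v K (\<lambda>t. B1 t \<omega>) (\<lambda>t. B2 t \<omega>) t) \<in> borel_measurable M"
    "(\<lambda>\<omega>. upper_regulator x y v K (\<lambda>t. B1 t \<omega>) (\<lambda>t. B2 t \<omega>) t) \<in> borel_measurable M"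
    by (simp_all add: lower_regulator_def upper_regulator_def Y_def)
qed

section \<open>The system driven by Brownian motions\<close>

theorem theorem4p1:
  fixes M :: "'a measure" and B1 B2 :: "real \<Rightarrow> 'a \<Rightarrow> real" and x y v K :: real
  assumes "prob_space M"
    and "standard_brownian_motion M B1" and "standard_brownian_motion M B2"
    and "independent_processes M B1 B2"
    and "x > 0" and "0 \<le> y" and "y \<le> x" and "K > 0"
  shows "\<exists>L1 L2 T. inert_solution M x y v K B1 B2 L1 L2 T \<and>
           (\<forall>L1' L2' T'. inert_solution M x y v K B1 B2 L1' L2' T' \<longrightarrow>
              (AE \<omega> in M. T' \<omega> = T \<omega> \<and>
                 (\<forall>t\<in>times_upto (T \<omega>). L1' t \<omega> = L1 t \<omega> \<and> L2' t \<omega> = L2 t \<omega>)))"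
proof -
  have good: "AE \<omega> in M. B1 0 \<omega> = 0 \<and> continuous_on {0..} (\<lambda>t. B1 t \<omega>) \<and>
      B2 0 \<omega> = 0 \<and> continuous_on {0..} (\<lambda>t. B2 t \<omega>)"
    using assms(2,3) unfolding standard_brownian_motion_def by simp
  obtain N where N: "\<And>\<omega>. \<omega> \<in> space M - N \<Longrightarrow>
      B1 0 \<omega> = 0 \<and> continuous_on {0..} (\<lambda>t. B1 t \<omega>) \<and>
      B2 0 \<omega> = 0 \<and> continuous_on {0..} (\<lambda>t. B2 t \<omega>)" "N \<in> null_sets M"
    by (rule AE_E3[OF good]) blast
  \<comment> \<open>Exceptional paths are replaced by \<open>0\<close>, so that every path is continuous and the construction is
      measurable even if \<open>M\<close> is not complete.\<close>
  define C1 where "C1 t \<omega> = (if \<omega> \<in> N then 0 else B1 t \<omega>)" for t \<omega>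
  define C2 where "C2 t \<omega> = (if \<omega> \<in> N then 0 else B2 t \<omega>)" for t \<omega>
  have cont: "continuous_on {0..} (\<lambda>t. C1 t \<omega>)" "continuous_on {0..} (\<lambda>t. C2 t \<omega>)"
    and zero: "C1 0 \<omega> = 0" "C2 0 \<omega> = 0" if "\<omega> \<in> space M" for \<omega>
    using N(1)[of \<omega>] that by (cases "\<omega> \<in> N"; simp add: C1_def C2_def)+
  have "N \<in> sets M" using N(2) by auto
  then have meas: "C1 t \<in> borel_measurable M" "C2 t \<in> borel_measurable M" if "0 \<le> t" for t
    using assms(2,3) that unfolding standard_brownian_motion_def C1_def C2_def by (auto intro!: measurable_If_set)
  have agree: "AE \<omega> in M. (\<lambda>t. B1 t \<omega>) = (\<lambda>t. C1 t \<omega>) \<and> (\<lambda>t. B2 t \<omega>) = (\<lambda>t. C2 t \<omega>)"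
    using AE_not_in[OF N(2)] by eventually_elim (simp add: C1_def C2_def)
  define L1 where "L1 t \<omega> = lower_regulator x y v K (\<lambda>t. C1 t \<omega>) (\<lambda>t. C2 t \<omega>) t" for t \<omega>
  define L2 where "L2 t \<omega> = upper_regulator x y v K (\<lambda>t. C1 t \<omega>) (\<lambda>t. C2 t \<omega>) t" for t \<omega>
  define T where "T \<omega> = first_zero (gap x y v K (\<lambda>t. C1 t \<omega>) (\<lambda>t. C2 t \<omega>))" for \<omega>
  have measL: "L1 t \<in> borel_measurable M" "L2 t \<in> borel_measurable M" if "0 \<le> t" for t
    unfolding L1_def L2_def by (intro regulators_measurable meas cont \<open>K > 0\<close> that; assumption)+
  have "T \<in> borel_measurable M"
    unfolding T_def
  proof (rule first_zero_measurable)
    fix t :: real assume "0 \<le> t"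
    then show "(\<lambda>\<omega>. gap x y v K (\<lambda>t. C1 t \<omega>) (\<lambda>t. C2 t \<omega>) t) \<in> borel_measurable M"
      using measL meas unfolding L1_def L2_def gap_def path_X1_def path_X2_def by simp
  next
    fix \<omega> assume "\<omega> \<in> space M"
    then show "continuous_on {0..} (gap x y v K (\<lambda>t. C1 t \<omega>) (\<lambda>t. C2 t \<omega>))"
      using assms(6-8) by (intro regulators_admissible(5) cont zero)
  qed
  moreover have "process_upto M T L1" "process_upto M T L2"
    unfolding process_upto_def using measL by (auto intro: measurable_restrict_space1)
  moreover have sys: "AE \<omega> in M. inert_path_system x y v K (\<lambda>t. B1 t \<omega>) (\<lambda>t. B2 t \<omega>)
      (\<lambda>t. L1 t \<omega>) (\<lambda>t. L2 t \<omega>) (T \<omega>)"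
    using agree AE_space
  proof eventually_elim
    case (elim \<omega>)
    then show ?case
      using inert_path_system_exists[where v = v, OF cont zero assms(6-8)]
      by (simp add: L1_def L2_def T_def)
  qed
  ultimately have "inert_solution M x y v K B1 B2 L1 L2 T" by (simp add: inert_solution_def)
  moreover have "AE \<omega> in M. T' \<omega> = T \<omega> \<and>
      (\<forall>t\<in>times_upto (T \<omega>). L1' t \<omega> = L1 t \<omega> \<and> L2' t \<omega> = L2 t \<omega>)"
    if "inert_solution M x y v K B1 B2 L1' L2' T'" for L1' L2' T'
  proof -
    have "AE \<omega> in M. inert_path_system x y v K (\<lambda>t. B1 t \<omega>) (\<lambda>t. B2 t \<omega>)
      (\<lambda>t. L1' t \<omega>) (\<lambda>t. L2' t \<omega>) (T' \<omega>)"
      using that by (simp add: inert_solution_def)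
    then show ?thesis
      using sys agree AE_space
    proof eventually_elim
      case (elim \<omega>)
      have b: "continuous_on {0..} (\<lambda>t. B1 t \<omega>)" "continuous_on {0..} (\<lambda>t. B2 t \<omega>)"
        using elim(3) cont[OF elim(4)] by metis+
      have "T' \<omega> = T \<omega>"
        using inert_path_system_time_le[OF elim(2,1) b \<open>K > 0\<close>]
          inert_path_system_time_le[OF elim(1,2) b \<open>K > 0\<close>] by (rule antisym)
      then show ?case
        using inert_path_system_agree[OF elim(2,1) b \<open>K > 0\<close>] by auto
    qed
  qed
  ultimately show ?thesis by blast
qed

end
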